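(* Suppose $m\in\omega$ and $0<\delta<\varepsilon<1$. There exists $n\in\omega$ such that for every finite set $I\subseteq\omega$ with $|I|>n$ there exists a set $C\subseteq 2^I$ such that $1-\varepsilon+\delta \geq |C|\cdot 2^{-|I|}\geq 1-\varepsilon-\delta$ and for every $f\in \mathsf F^I_{\emptyset,m}$, $$\left|\frac{|(C)^f|}{|(C)^\emptyset|} - (1-\varepsilon)^{m^0_f}\varepsilon^{m^1_f}\right| < \delta.$$
   Context: For a finite set $I\subseteq\omega$, $2^I$ is the set of functions $I\to\{0,1\}$, a group under coordinatewise addition mod 2; for $B\subseteq 2^I$ and $s\in 2^I$, $B+s=\{b+s:b\in B\}$. $\mathsf F^I$ is the set of all functions $f$ with $\operatorname{dom}(f)\subseteq 2^I$ and values in $\{0,1\}$; for such $f$, $m^0_f = |\{s: f(s)=0\}|$ and $m^1_f = |\{s:f(s)=1\}|$. For $B\subseteq 2^I$ let $(B)^0 = B$ and $(B)^1 = 2^I\setminus B$, and for $f\in\mathsf F^I$ let $(B)^f = \bigcap_{s\in\operatorname{dom}(f)} (B+s)^{f(s)}$, with $(B)^\emptyset = 2^I$. $\mathsf F^I_{\emptyset,m}$ is the set of $f\in\mathsf F^I$ with $|\operatorname{dom}(f)|\leq m$. *)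

theory Defs
  imports Complex_Main "HOL-Library.FuncSet" "HOL-Library.Z2"
begin

text \<open>
  The set $\{0,1\}$ with addition mod 2 is the two-element field \<^typ>\<open>bit\<close>.  Functions with domain
  \<open>I\<close> are the extensional functions on \<open>I\<close> (value \<open>undefined\<close> off \<open>I\<close>), so that distinct
  elements of \<open>cube I\<close> differ somewhere on \<open>I\<close>.
\<close>

definition cube :: "nat set \<Rightarrow> (nat \<Rightarrow> bit) set" where
  "cube I = I \<rightarrow>\<^sub>E UNIV"

definition translate :: "nat set \<Rightarrow> (nat \<Rightarrow> bit) set \<Rightarrow> (nat \<Rightarrow> bit) \<Rightarrow> (nat \<Rightarrow> bit) set" where
  "translate I B s = (\<lambda>b. \<lambda>i\<in>I. b i + s i) ` B"

definition signed :: "nat set \<Rightarrow> (nat \<Rightarrow> bit) set \<Rightarrow> bit \<Rightarrow> (nat \<Rightarrow> bit) set" where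
  "signed I B j = (if j = 0 then B else cube I - B)"

definition partial_functions :: "nat set \<Rightarrow> ((nat \<Rightarrow> bit) \<rightharpoonup> bit) set" where
  "partial_functions I = {f. dom f \<subseteq> cube I}"

definition partial_functions_upto :: "nat set \<Rightarrow> nat \<Rightarrow> ((nat \<Rightarrow> bit) \<rightharpoonup> bit) set" where
  "partial_functions_upto I m = {f \<in> partial_functions I. finite (dom f) \<and> card (dom f) \<le> m}"

definition value_count :: "bit \<Rightarrow> ((nat \<Rightarrow> bit) \<rightharpoonup> bit) \<Rightarrow> nat" where
  "value_count j f = card {s. f s = Some j}"

text \<open>
  The intersection is taken inside \<open>cube I\<close>.  This matters only for the empty \<open>f\<close>, where it gives
  the convention that the set is all of \<open>cube I\<close>; see the two lemmas below.
\<close>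

definition pattern_set :: "nat set \<Rightarrow> (nat \<Rightarrow> bit) set \<Rightarrow> ((nat \<Rightarrow> bit) \<rightharpoonup> bit) \<Rightarrow> (nat \<Rightarrow> bit) set" where
  "pattern_set I B f = cube I \<inter> (\<Inter>s\<in>dom f. signed I (translate I B s) (the (f s)))"

lemma pattern_set_empty: "pattern_set I B Map.empty = cube I"
  by (simp add: pattern_set_def)

lemma pattern_set_nonempty:
  assumes "f \<noteq> Map.empty"
  shows "pattern_set I B f = (\<Inter>s\<in>dom f. signed I (translate I B s) (the (f s)))"
proof -
  obtain s where s: "s \<in> dom f"
    using assms by auto
  have "signed I (translate I B s) (the (f s)) \<subseteq> cube I"
    by (auto simp: signed_def translate_def cube_def)
  with s show ?thesis
    unfolding pattern_set_def by blast
qed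

end

theory Submission
  imports Defs
begin

text \<open>
  Put each point of the cube into \<open>C\<close> independently with probability \<open>1 - \<epsilon>\<close>.  For a fixed \<open>f\<close> with
  \<open>k\<close> constraints, the expected density of \<open>(C)\<^sup>f\<close> is exactly the required product, because the \<open>k\<close>
  points \<open>x + s\<close> are distinct for every \<open>x\<close>; and adding one point to \<open>C\<close> changes \<open>card (C)\<^sup>f\<close> by at
  most \<open>k\<close>.  A bounded-differences inequality therefore makes a deviation by \<open>\<delta> N\<close>, where \<open>N\<close> is the
  size of the cube, exponentially unlikely in \<open>N\<close>, whereas there are only polynomially many \<open>f\<close>
  (a second-moment bound would not survive this union bound).  The density of \<open>C\<close> itself is the case
  of the one-point function \<open>0 \<mapsto> 0\<close>.
\<close>

section \<open>Random subsets and bounded differences\<close>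

text \<open>For finite \<open>U\<close> and \<open>p\<close> in [0,1] this is the expectation of
  \<open>F A\<close> when \<open>A\<close> contains each point of \<open>U\<close> independently
  with probability \<open>p\<close>. As a finite weighted sum it needs no measure space.\<close>

definition bernoulli_mean :: "real \<Rightarrow> 'a set \<Rightarrow> ('a set \<Rightarrow> real) \<Rightarrow> real" where
  "bernoulli_mean p U F = (\<Sum>A\<in>Pow U. p ^ card A * (1 - p) ^ card (U - A) * F A)"

lemma bernoulli_mean_empty [simp]: "bernoulli_mean p {} F = F {}"
  by (simp add: bernoulli_mean_def)

text \<open>Conditioning on whether \<open>x\<close> is chosen; the induction behind the exponential
  moment bound runs on this recursion.\<close>

lemma bernoulli_mean_insert:
  assumes "finite U" "x \<notin> U"
  shows "bernoulli_mean p (insert x U) F =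
    bernoulli_mean p U (\<lambda>A. p * F (insert x A) + (1 - p) * F A)"
proof -
  let ?w = "\<lambda>A. p ^ card A * (1 - p) ^ card (insert x U - A) * F A"
  have inj: "inj_on (insert x) (Pow U)"
    using assms(2) by (intro inj_onI) (metis PowD insert_ident subsetD)
  have disj: "Pow U \<inter> insert x ` Pow U = {}"
    using assms(2) by auto
  have "bernoulli_mean p (insert x U) F = sum ?w (Pow U) + sum ?w (insert x ` Pow U)"
    unfolding bernoulli_mean_def Pow_insert
    using assms(1) disj by (intro sum.union_disjoint) auto
  also have "sum ?w (insert x ` Pow U) = (\<Sum>A\<in>Pow U. ?w (insert x A))"
    by (simp add: sum.reindex[OF inj])
  also have "sum ?w (Pow U) + \<dots> = (\<Sum>A\<in>Pow U. ?w A + ?w (insert x A))"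
    by (simp add: sum.distrib)
  also have "\<dots> = bernoulli_mean p U (\<lambda>A. p * F (insert x A) + (1 - p) * F A)"
    unfolding bernoulli_mean_def
  proof (rule sum.cong[OF refl])
    fix A assume "A \<in> Pow U"
    then have A: "A \<subseteq> U" "x \<notin> A" "finite A"
      using assms finite_subset by auto
    have "insert x U - A = insert x (U - A)" "insert x U - insert x A = U - A"
      using A assms(2) by auto
    then show "?w A + ?w (insert x A) =
        p ^ card A * (1 - p) ^ card (U - A) * (p * F (insert x A) + (1 - p) * F A)"
      using A assms by (simp add: algebra_simps)
  qed
  finally show ?thesis .
qed

lemma bernoulli_mean_mono:
  assumes "0 \<le> p" "p \<le> 1" "\<And>A. A \<subseteq> U \<Longrightarrow> F A \<le> G A"
  shows "bernoulli_mean p U F \<le> bernoulli_mean p U G"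
  unfolding bernoulli_mean_def using assms
  by (intro sum_mono mult_left_mono) auto

lemma bernoulli_mean_sum:
  "bernoulli_mean p U (\<lambda>A. \<Sum>j\<in>J. F j A) = (\<Sum>j\<in>J. bernoulli_mean p U (F j))"
  unfolding bernoulli_mean_def sum_distrib_left by (rule sum.swap)

lemma bernoulli_mean_mult: "bernoulli_mean p U (\<lambda>A. c * F A) = c * bernoulli_mean p U F"
  by (simp add: bernoulli_mean_def sum_distrib_left mult_ac)

text \<open>Independence of the points, in the form of expanding a product of sums over the subsets
  of \<open>U\<close>.\<close>

lemma bernoulli_mean_cylinder:
  assumes "finite U" "P \<subseteq> U" "Q \<subseteq> U" "P \<inter> Q = {}"
  shows "bernoulli_mean p U (\<lambda>A. of_bool (P \<subseteq> A \<and> Q \<inter> A = {})) = p ^ card P * (1 - p) ^ card Q"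
proof -
  \<comment> \<open>The event is absorbed into the weights: \<open>a\<close> vanishes on a point of
    \<open>Q\<close> that is chosen, \<open>b\<close> on a point of \<open>P\<close> that is
    omitted.\<close>
  define a where "a u = p * of_bool (u \<notin> Q)" for u
  define b where "b u = (1 - p) * of_bool (u \<notin> P)" for u
  have fin: "finite P" "finite Q"
    using assms(1-3) by (auto intro: finite_subset)
  have "bernoulli_mean p U (\<lambda>A. of_bool (P \<subseteq> A \<and> Q \<inter> A = {})) =
      (\<Sum>A\<in>Pow U. prod a A * prod b (U - A))"
    unfolding bernoulli_mean_def
  proof (rule sum.cong[OF refl])
    fix A assume "A \<in> Pow U"
    then have A: "A \<subseteq> U" "finite A"
      using assms(1) finite_subset by auto
    have "prod a A = p ^ card A * of_bool (Q \<inter> A = {})"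
      unfolding a_def prod.distrib using A(2) by (auto intro!: prod.neutral)
    moreover have "prod b (U - A) = (1 - p) ^ card (U - A) * of_bool (P \<subseteq> A)"
      unfolding b_def prod.distrib using assms(1,2) by (auto intro!: prod.neutral)
    ultimately show "p ^ card A * (1 - p) ^ card (U - A) * of_bool (P \<subseteq> A \<and> Q \<inter> A = {}) =
        prod a A * prod b (U - A)"
      by auto
  qed
  also have "\<dots> = (\<Prod>u\<in>U. a u + b u)"
    using assms(1) by (simp add: prod_add)
  \<comment> \<open>Every point outside both sets contributes p + (1 - p) = 1.\<close>
  also have "\<dots> = (\<Prod>u\<in>P \<union> Q. a u + b u)"
    using assms by (intro prod.mono_neutral_right) (auto simp: a_def b_def)
  also have "\<dots> = (\<Prod>u\<in>P. a u + b u) * (\<Prod>u\<in>Q. a u + b u)"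
    using fin assms(4) by (rule prod.union_disjoint)
  also have "(\<Prod>u\<in>P. a u + b u) = (\<Prod>u\<in>P. p)"
    using assms(4) by (intro prod.cong) (auto simp: a_def b_def)
  also have "(\<Prod>u\<in>Q. a u + b u) = (\<Prod>u\<in>Q. 1 - p)"
    using assms(4) by (intro prod.cong) (auto simp: a_def b_def)
  finally show ?thesis by simp
qed

lemma bernoulli_mean_const: "finite U \<Longrightarrow> bernoulli_mean p U (\<lambda>A. c) = c"
  using bernoulli_mean_mult[of p U c "\<lambda>_. 1"] bernoulli_mean_cylinder[of U "{}" "{}" p] by simp

section \<open>Exponential moments and concentration\<close>

lemma exp_le_quadratic:
  fixes y :: real
  assumes "\<bar>y\<bar> \<le> 1"
  shows "exp y \<le> 1 + y + y\<^sup>2"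
proof (cases "0 \<le> y")
  case True
  then show ?thesis using assms exp_bound by auto
next
  case False
  define z where "z = - y"
  have z: "0 < z" using False by (simp add: z_def)
  \<comment> \<open>The product equals 1 + z^3.\<close>
  have "1 \<le> (1 - z + z\<^sup>2) * (1 + z)"
    using z by (simp add: algebra_simps power2_eq_square)
  also have "\<dots> \<le> (1 - z + z\<^sup>2) * exp z"
    using assms False exp_ge_add_one_self[of z] by (intro mult_left_mono) (auto simp: z_def)
  finally have "exp (- z) \<le> 1 - z + z\<^sup>2"
    by (simp add: exp_minus field_simps)
  then show ?thesis by (simp add: z_def)
qed

text \<open>A Hoeffding-type estimate with a crude constant: after centring at the mean \<mu>, the
  linear terms of the quadratic bounds cancel, and the variance p(1 - p)d^2 is at most d^2.\<close>

lemma two_point_exp_bound: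
  fixes p a b :: real
  assumes "0 \<le> p" "p \<le> 1" "\<bar>a - b\<bar> \<le> 1"
  shows "p * exp a + (1 - p) * exp b \<le> exp (p * a + (1 - p) * b + (a - b)\<^sup>2)"
proof -
  define \<mu> where "\<mu> = p * a + (1 - p) * b"
  define d where "d = a - b"
  have a: "a = \<mu> + (1 - p) * d" and b: "b = \<mu> + (- p * d)"
    by (simp_all add: \<mu>_def d_def algebra_simps)
  have d: "\<bar>d\<bar> \<le> 1" using assms by (simp add: d_def)
  have "exp ((1 - p) * d) \<le> 1 + (1 - p) * d + ((1 - p) * d)\<^sup>2"
    using assms d by (intro exp_le_quadratic) (simp add: abs_mult mult_le_one)
  moreover have "exp (- p * d) \<le> 1 + - p * d + (- p * d)\<^sup>2"
    using assms d by (intro exp_le_quadratic) (simp add: abs_mult mult_le_one)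
  ultimately have "p * exp ((1 - p) * d) + (1 - p) * exp (- p * d) \<le>
      p * (1 + (1 - p) * d + ((1 - p) * d)\<^sup>2) + (1 - p) * (1 + - p * d + (- p * d)\<^sup>2)"
    using assms by (intro add_mono mult_left_mono) auto
  also have "\<dots> = 1 + (p * (1 - p)) * d\<^sup>2"
    by (simp add: algebra_simps power2_eq_square)
  also have "\<dots> \<le> 1 + 1 * d\<^sup>2"
    using assms by (intro add_left_mono mult_right_mono mult_le_one) auto
  also have "\<dots> \<le> exp (d\<^sup>2)"
    by simp
  finally have "exp \<mu> * (p * exp ((1 - p) * d) + (1 - p) * exp (- p * d)) \<le> exp \<mu> * exp (d\<^sup>2)"
    by simp
  moreover have "exp a = exp \<mu> * exp ((1 - p) * d)" "exp b = exp \<mu> * exp (- p * d)"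
    unfolding a b exp_add by (simp_all only: flip: a b)
  ultimately show ?thesis
    unfolding \<mu>_def[symmetric] d_def[symmetric] exp_add by (simp add: algebra_simps)
qed

text \<open>Averaging out one point at a time costs a factor exp(c^2) each, by the two-point bound,
  and the averaged function satisfies the same difference bound on the remaining points.\<close>

lemma bernoulli_mean_exp_le:
  assumes "finite U" "0 \<le> p" "p \<le> 1" "c \<le> 1"
    and "\<And>x A. x \<in> U \<Longrightarrow> A \<subseteq> U \<Longrightarrow> \<bar>F (insert x A) - F A\<bar> \<le> c"
  shows "bernoulli_mean p U (\<lambda>A. exp (F A)) \<le> exp (bernoulli_mean p U F + c\<^sup>2 * card U)"
  using assms(1,5)
proof (induction U arbitrary: F rule: finite_induct)
  case empty
  then show ?case by simp
next
  case (insert x U)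
  \<comment> \<open>\<open>G\<close> is the conditional expectation of \<open>F\<close> given the
    choices on \<open>U\<close>; its mean over \<open>U\<close> is the mean of \<open>F\<close> over
    \<open>insert x U\<close>.\<close>
  define G where "G A = p * F (insert x A) + (1 - p) * F A" for A
  have G_lip: "\<bar>G (insert y A) - G A\<bar> \<le> c" if "y \<in> U" "A \<subseteq> U" for y A
  proof -
    have "G (insert y A) - G A = p * (F (insert y (insert x A)) - F (insert x A)) +
        (1 - p) * (F (insert y A) - F A)"
      by (simp add: G_def algebra_simps insert_commute)
    also have "\<bar>\<dots>\<bar> \<le> p * \<bar>F (insert y (insert x A)) - F (insert x A)\<bar> +
        (1 - p) * \<bar>F (insert y A) - F A\<bar>"
      using assms(2,3) abs_triangle_ineq by (metis abs_mult abs_of_nonneg diff_ge_0_iff_ge)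
    also have "\<dots> \<le> p * c + (1 - p) * c"
      using assms(2,3) that by (intro add_mono mult_left_mono insert.prems) auto
    finally show ?thesis by (simp add: algebra_simps)
  qed
  have "bernoulli_mean p (insert x U) (\<lambda>A. exp (F A)) =
      bernoulli_mean p U (\<lambda>A. p * exp (F (insert x A)) + (1 - p) * exp (F A))"
    using insert.hyps by (rule bernoulli_mean_insert)
  also have "\<dots> \<le> bernoulli_mean p U (\<lambda>A. exp (c\<^sup>2) * exp (G A))"
  proof (rule bernoulli_mean_mono[OF assms(2,3)])
    fix A assume "A \<subseteq> U"
    then have *: "\<bar>F (insert x A) - F A\<bar> \<le> c"
      by (intro insert.prems) auto
    then have "p * exp (F (insert x A)) + (1 - p) * exp (F A) \<le>
        exp (G A + (F (insert x A) - F A)\<^sup>2)"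
      unfolding G_def using assms by (intro two_point_exp_bound) auto
    also have "\<dots> \<le> exp (G A + c\<^sup>2)"
      using power_mono[OF *, of 2] by simp
    finally show "p * exp (F (insert x A)) + (1 - p) * exp (F A) \<le> exp (c\<^sup>2) * exp (G A)"
      by (simp add: exp_add mult.commute)
  qed
  also have "\<dots> = exp (c\<^sup>2) * bernoulli_mean p U (\<lambda>A. exp (G A))"
    by (rule bernoulli_mean_mult)
  also have "\<dots> \<le> exp (c\<^sup>2) * exp (bernoulli_mean p U G + c\<^sup>2 * card U)"
    using G_lip by (intro mult_left_mono insert.IH) auto
  also have "bernoulli_mean p U G = bernoulli_mean p (insert x U) F"
    using bernoulli_mean_insert[OF insert.hyps, of p F] by (simp add: G_def[abs_def])
  also have "exp (c\<^sup>2) * exp (bernoulli_mean p (insert x U) F + c\<^sup>2 * card U) =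
      exp (bernoulli_mean p (insert x U) F + c\<^sup>2 * card (insert x U))"
    unfolding mult_exp_exp card_insert_disjoint[OF insert.hyps] of_nat_Suc
    by (rule arg_cong[where f = exp]) (simp add: algebra_simps)
  finally show ?case .
qed

text \<open>
  The bound \<open>t\<^sup>2 c\<^sup>2 n - t a\<close> on the exponent at scale \<open>t\<close> is minimal at \<open>t = a / (2 c\<^sup>2 n)\<close>.
\<close>

lemma bounded_differences_tail:
  fixes a c :: real
  assumes "finite U" "U \<noteq> {}" "0 \<le> p" "p \<le> 1" "0 < c" "0 < a" "a \<le> 2 * c * card U"
    and "\<And>x A. x \<in> U \<Longrightarrow> A \<subseteq> U \<Longrightarrow> \<bar>F (insert x A) - F A\<bar> \<le> c"
  defines "t \<equiv> a / (2 * c\<^sup>2 * card U)"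
  shows "bernoulli_mean p U (\<lambda>A. exp (t * (F A - bernoulli_mean p U F - a))) \<le>
    exp (- a\<^sup>2 / (4 * c\<^sup>2 * card U))"
proof -
  let ?n = "real (card U)" and ?\<mu> = "bernoulli_mean p U F"
  have n: "0 < ?n" using assms(1,2) by (simp add: card_gt_0_iff)
  have t: "0 < t" using n assms by (simp add: t_def)
  \<comment> \<open>The assumed upper bound on \<open>a\<close> is exactly what brings the
    difference bound of t * F down to 1, as the moment bound requires.\<close>
  have tc: "t * c \<le> 1"
    using n assms(5,7) by (simp add: t_def power2_eq_square field_simps)
  have "bernoulli_mean p U (\<lambda>A. exp (t * (F A - ?\<mu> - a))) =
      bernoulli_mean p U (\<lambda>A. exp (- t * ?\<mu> - t * a) * exp (t * F A))"
    unfolding mult_exp_exp by (simp add: algebra_simps)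
  also have "\<dots> = exp (- t * ?\<mu> - t * a) * bernoulli_mean p U (\<lambda>A. exp (t * F A))"
    by (rule bernoulli_mean_mult)
  also have "\<dots> \<le> exp (- t * ?\<mu> - t * a) *
      exp (bernoulli_mean p U (\<lambda>A. t * F A) + (t * c)\<^sup>2 * ?n)"
  proof (intro mult_left_mono bernoulli_mean_exp_le assms(1,3,4) tc)
    fix x A assume "x \<in> U" "A \<subseteq> U"
    then have "t * \<bar>F (insert x A) - F A\<bar> \<le> t * c"
      using t assms(8) by simp
    then show "\<bar>t * F (insert x A) - t * F A\<bar> \<le> t * c"
      using t by (simp add: abs_mult right_diff_distrib[symmetric])
  qed simp
  also have "\<dots> = exp ((t * c)\<^sup>2 * ?n - t * a)"
    unfolding mult_exp_exp bernoulli_mean_mult by (rule arg_cong[where f = exp]) simp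
  also have "(t * c)\<^sup>2 * ?n - t * a = - a\<^sup>2 / (4 * c\<^sup>2 * ?n)"
    using n assms(5) by (simp add: t_def power2_eq_square field_simps)
  finally show ?thesis .
qed

text \<open>Markov's inequality and the union bound in one: if every \<open>A\<close> failed for
  some \<open>j\<close>, the sum of all exponential tail functions would be at least 1 pointwise,
  yet its mean is at most the left side of \<open>small\<close>.\<close>

lemma exists_set_near_means:
  fixes a c :: real
  assumes "finite U" "U \<noteq> {}" "0 \<le> p" "p \<le> 1" "0 < c" "0 < a" "a \<le> 2 * c * card U"
    and "finite J"
    and lip: "\<And>j x A. j \<in> J \<Longrightarrow> x \<in> U \<Longrightarrow> A \<subseteq> U \<Longrightarrow> \<bar>F j (insert x A) - F j A\<bar> \<le> c"
    and small: "2 * card J * exp (- a\<^sup>2 / (4 * c\<^sup>2 * card U)) < 1"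
  shows "\<exists>A\<subseteq>U. \<forall>j\<in>J. \<bar>F j A - bernoulli_mean p U (F j)\<bar> < a"
proof (rule ccontr)
  assume contr: "\<not> ?thesis"
  define t where "t = a / (2 * c\<^sup>2 * card U)"
  define \<mu> where "\<mu> j = bernoulli_mean p U (F j)" for j
  let ?E = "exp (- a\<^sup>2 / (4 * c\<^sup>2 * card U))"
  define upper where "upper j A = exp (t * (F j A - \<mu> j - a))" for j A
  define lower where "lower j A = exp (t * (\<mu> j - F j A - a))" for j A
  have t: "0 < t" using assms(1,2,5,6) by (simp add: t_def card_gt_0_iff)
  \<comment> \<open>The lower tail is the upper tail of the negated function.\<close>
  have "bernoulli_mean p U (\<lambda>A. exp (t * (- F j A - bernoulli_mean p U (\<lambda>A. - F j A) - a))) \<le> ?E"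
    if "j \<in> J" for j
    unfolding t_def using lip[OF that] assms(1-7)
    by (intro bounded_differences_tail) (auto simp: abs_minus_commute)
  moreover have "bernoulli_mean p U (\<lambda>A. - F j A) = - \<mu> j" for j
    using bernoulli_mean_mult[of p U "-1" "F j"] by (simp add: \<mu>_def)
  ultimately have lower: "bernoulli_mean p U (lower j) \<le> ?E" if "j \<in> J" for j
    using that by (simp add: lower_def[abs_def])
  have upper: "bernoulli_mean p U (upper j) \<le> ?E" if "j \<in> J" for j
    unfolding upper_def[abs_def] \<mu>_def t_def using lip[OF that] assms(1-7)
    by (intro bounded_differences_tail) auto
  have "1 = bernoulli_mean p U (\<lambda>A. 1)"
    using assms(1) by (simp add: bernoulli_mean_const)
  also have "\<dots> \<le> bernoulli_mean p U (\<lambda>A. (\<Sum>j\<in>J. upper j A) + (\<Sum>j\<in>J. lower j A))"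
  proof (rule bernoulli_mean_mono[OF assms(3,4)])
    fix A assume "A \<subseteq> U"
    then obtain j where j: "j \<in> J" "a \<le> \<bar>F j A - \<mu> j\<bar>"
      using contr by (auto simp: \<mu>_def not_less)
    \<comment> \<open>A deviation of at least \<open>a\<close> makes one of the two exponents
      nonnegative.\<close>
    then have "1 \<le> upper j A \<or> 1 \<le> lower j A"
      using t by (auto simp: upper_def lower_def abs_if split: if_splits)
    moreover have "upper j A \<le> (\<Sum>j\<in>J. upper j A)" "lower j A \<le> (\<Sum>j\<in>J. lower j A)"
      using j(1) assms(8) by (auto intro!: member_le_sum simp: upper_def lower_def)
    moreover have "0 \<le> (\<Sum>j\<in>J. upper j A)" "0 \<le> (\<Sum>j\<in>J. lower j A)"
      by (auto intro!: sum_nonneg simp: upper_def lower_def)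
    ultimately show "1 \<le> (\<Sum>j\<in>J. upper j A) + (\<Sum>j\<in>J. lower j A)"
      by linarith
  qed
  also have "\<dots> = (\<Sum>j\<in>J. bernoulli_mean p U (upper j)) + (\<Sum>j\<in>J. bernoulli_mean p U (lower j))"
    unfolding bernoulli_mean_sum[symmetric]
    by (simp add: bernoulli_mean_def distrib_left sum.distrib)
  also have "\<dots> \<le> (\<Sum>j\<in>J. ?E) + (\<Sum>j\<in>J. ?E)"
    using upper lower by (intro add_mono sum_mono) auto
  also have "\<dots> < 1"
    using small by simp
  finally show False by simp
qed

section \<open>Patterns in the cube\<close>

definition shift :: "nat set \<Rightarrow> (nat \<Rightarrow> bit) \<Rightarrow> (nat \<Rightarrow> bit) \<Rightarrow> (nat \<Rightarrow> bit)" where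
  "shift I s x = (\<lambda>i\<in>I. x i + s i)"

lemma shift_in_cube [simp]: "shift I s x \<in> cube I"
  by (auto simp: shift_def cube_def)

text \<open>Lets x + s be read also as the translate of \<open>s\<close> by \<open>x\<close>, so
  that distinct constraints \<open>s\<close> give distinct points for fixed
  \<open>x\<close>.\<close>

lemma shift_commute: "shift I s x = shift I x s"
  unfolding shift_def by (intro restrict_ext add.commute)

text \<open>In characteristic 2 each translation is its own inverse; off \<open>I\<close> both sides
  are \<open>undefined\<close>, since \<open>x\<close> is extensional.\<close>

lemma shift_shift [simp]:
  assumes "x \<in> cube I"
  shows "shift I s (shift I s x) = x"
proof
  have "b + c + c = b" for b c :: bit
    by (cases b; cases c) auto
  then show "shift I s (shift I s x) i = x i" for i
    using assms by (cases "i \<in> I") (auto simp: shift_def cube_def PiE_def extensional_def)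
qed

lemma inj_on_shift: "inj_on (shift I s) (cube I)"
  by (rule inj_on_inverseI[of _ "shift I s"]) simp

lemma shift_eq_iff:
  assumes "x \<in> cube I" "y \<in> cube I"
  shows "shift I s x = y \<longleftrightarrow> x = shift I s y"
  using assms by auto

lemma UNIV_bit: "(UNIV :: bit set) = {0, 1}"
  by (auto intro: bit_not_zero_iff[THEN iffD1])

lemma all_bit: "(\<forall>b :: bit. P b) \<longleftrightarrow> P 0 \<and> P 1"
proof -
  have "(\<forall>b :: bit. P b) \<longleftrightarrow> (\<forall>b\<in>UNIV. P b)"
    by (rule ball_UNIV[symmetric])
  then show ?thesis unfolding UNIV_bit by simp
qed

lemma finite_cube: "finite I \<Longrightarrow> finite (cube I)"
  unfolding cube_def by (intro finite_PiE) (auto simp: UNIV_bit)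

lemma card_cube: "finite I \<Longrightarrow> card (cube I) = 2 ^ card I"
  by (simp add: cube_def card_PiE UNIV_bit numeral_2_eq_2)

lemma mem_translate:
  assumes "B \<subseteq> cube I" "x \<in> cube I"
  shows "x \<in> translate I B s \<longleftrightarrow> shift I s x \<in> B"
proof -
  have "translate I B s = shift I s ` B"
    by (simp add: translate_def shift_def)
  then show ?thesis
    using assms by (auto simp: image_iff subset_eq) (metis shift_shift)
qed

section \<open>Mean and bounded differences of the pattern counts\<close>

text \<open>Since -s = s, \<open>x\<close> lies in A + s iff x + s lies in \<open>A\<close>. For
  fixed \<open>x\<close> the pattern thus becomes a cylinder event in \<open>A\<close>, the form
  that \<open>bernoulli_mean_cylinder\<close> evaluates.\<close>

lemma mem_pattern_set:
  assumes "A \<subseteq> cube I"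
  shows "x \<in> pattern_set I A f \<longleftrightarrow> x \<in> cube I \<and>
    shift I x ` {s. f s = Some 0} \<subseteq> A \<and> shift I x ` {s. f s = Some 1} \<inter> A = {}"
proof (cases "x \<in> cube I")
  case True
  have signed: "x \<in> signed I (translate I A s) b \<longleftrightarrow> (shift I s x \<in> A \<longleftrightarrow> b = 0)" for s b
    unfolding mem_translate[OF assms True, symmetric] signed_def using True by auto
  have "x \<in> pattern_set I A f \<longleftrightarrow> (\<forall>s\<in>dom f. shift I s x \<in> A \<longleftrightarrow> the (f s) = 0)"
    unfolding pattern_set_def Int_iff INT_iff signed using True by blast
  also have "\<dots> \<longleftrightarrow> (\<forall>b s. f s = Some b \<longrightarrow> (shift I s x \<in> A \<longleftrightarrow> b = 0))"
    by (auto simp: dom_def)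
  also have "\<dots> \<longleftrightarrow> (\<forall>s. f s = Some 0 \<longrightarrow> shift I x s \<in> A) \<and>
      (\<forall>s. f s = Some 1 \<longrightarrow> shift I x s \<notin> A)"
    unfolding all_bit shift_commute[of I x] by simp
  finally show ?thesis using True by auto
qed (simp add: pattern_set_def)

lemma finite_pattern_set: "finite I \<Longrightarrow> finite (pattern_set I A f)"
  by (rule finite_subset[OF _ finite_cube]) (auto simp: pattern_set_def)

text \<open>Linearity of expectation over \<open>x\<close>. Injectivity of s \<mapsto> x + s keeps
  the required and the forbidden points disjoint and preserves their numbers.\<close>

lemma bernoulli_mean_card_pattern_set:
  fixes p :: real
  assumes "finite I" "dom f \<subseteq> cube I"
  shows "bernoulli_mean p (cube I) (\<lambda>A. card (pattern_set I A f)) =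
    card (cube I) * (p ^ value_count 0 f * (1 - p) ^ value_count 1 f)"
proof -
  let ?S = "\<lambda>j x. shift I x ` {s. f s = Some j}"
  have "bernoulli_mean p (cube I) (\<lambda>A. card (pattern_set I A f)) =
      bernoulli_mean p (cube I)
        (\<lambda>A. \<Sum>x\<in>cube I. of_bool (?S 0 x \<subseteq> A \<and> ?S 1 x \<inter> A = {}))"
    unfolding bernoulli_mean_def
  proof (rule sum.cong[OF refl])
    fix A assume "A \<in> Pow (cube I)"
    then have "pattern_set I A f = {x \<in> cube I. ?S 0 x \<subseteq> A \<and> ?S 1 x \<inter> A = {}}"
      by (intro set_eqI) (simp add: mem_pattern_set)
    then show "p ^ card A * (1 - p) ^ card (cube I - A) * real (card (pattern_set I A f)) =
        p ^ card A * (1 - p) ^ card (cube I - A) *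
          (\<Sum>x\<in>cube I. of_bool (?S 0 x \<subseteq> A \<and> ?S 1 x \<inter> A = {}))"
      using finite_cube[OF assms(1)] by (simp add: sum_of_bool_eq Int_def)
  qed
  also have "\<dots> = (\<Sum>x\<in>cube I. p ^ card (?S 0 x) * (1 - p) ^ card (?S 1 x))"
    unfolding bernoulli_mean_sum
  proof (intro sum.cong refl bernoulli_mean_cylinder finite_cube assms(1))
    fix x assume "x \<in> cube I"
    show "?S 0 x \<inter> ?S 1 x = {}"
    proof (rule ccontr)
      assume "?S 0 x \<inter> ?S 1 x \<noteq> {}"
      then obtain s s' where s: "f s = Some 0" "f s' = Some 1" "shift I x s = shift I x s'"
        by auto
      then have "s = s'"
        using assms(2) inj_on_shift[of I x] by (auto dest!: inj_onD)
      then show False using s by simp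
    qed
  qed auto
  also have "\<dots> = (\<Sum>x\<in>cube I. p ^ value_count 0 f * (1 - p) ^ value_count 1 f)"
  proof -
    have "card (?S j x) = value_count j f" for j x
      unfolding value_count_def
      by (intro card_image inj_on_subset[OF inj_on_shift]) (use assms(2) in auto)
    then show ?thesis by simp
  qed
  finally show ?thesis by simp
qed

lemma pattern_set_bounded_difference:
  assumes "finite I" "finite (dom f)" "u \<in> cube I" "A \<subseteq> cube I"
  shows "\<bar>real (card (pattern_set I (insert u A) f)) - real (card (pattern_set I A f))\<bar> \<le> card (dom f)"
proof -
  let ?X = "pattern_set I (insert u A) f" and ?Y = "pattern_set I A f"
  \<comment> \<open>Only an \<open>x\<close> with x + s = u for some constraint \<open>s\<close> can
    change status, that is, x = u + s.\<close>
  let ?D = "shift I u ` dom f"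
  have "x \<in> ?D" if "x \<in> ?X \<and> x \<notin> ?Y \<or> x \<in> ?Y \<and> x \<notin> ?X" for x
  proof -
    have x: "x \<in> cube I" using that by (auto simp: pattern_set_def)
    from that obtain s where s: "s \<in> dom f" "shift I x s = u"
      using assms(3,4) by (auto simp: mem_pattern_set)
    then have "x = shift I u s"
      using x shift_eq_iff[of x I u s] assms(3) by (simp add: shift_commute)
    then show ?thesis using s by auto
  qed
  then have sub: "?X \<subseteq> ?Y \<union> ?D" "?Y \<subseteq> ?X \<union> ?D" by auto
  have fin: "finite ?X" "finite ?Y" "finite ?D"
    using assms finite_pattern_set by auto
  have "card ?D \<le> card (dom f)"
    using assms(2) by (rule card_image_le)
  moreover have "card ?X \<le> card ?Y + card ?D" "card ?Y \<le> card ?X + card ?D"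
    using sub fin by (meson card_Un_le card_mono finite_UnI le_trans)+
  ultimately show ?thesis by linarith
qed

section \<open>Number of constraints against exponential decay\<close>

text \<open>Listing the graph of \<open>f\<close> without repetition writes \<open>f\<close> as
  \<open>map_of\<close> of a list of at most \<open>m\<close> pairs, and there are twice as many
  pairs as points of the cube.\<close>

lemma partial_functions_upto_bound:
  assumes "finite I"
  shows "finite (partial_functions_upto I m)"
    and "card (partial_functions_upto I m) \<le> (m + 1) * (2 * 2 ^ card I) ^ m"
proof -
  let ?T = "cube I \<times> (UNIV :: bit set)"
  let ?L = "{xs. set xs \<subseteq> ?T \<and> length xs \<le> m}"
  have T: "finite ?T" "card ?T = 2 * 2 ^ card I"
    using assms by (auto simp: finite_cube card_cube card_cartesian_product UNIV_bit)
  have sub: "partial_functions_upto I m \<subseteq> map_of ` ?L"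
  proof
    fix f assume "f \<in> partial_functions_upto I m"
    then have f: "dom f \<subseteq> cube I" "finite (dom f)" "card (dom f) \<le> m"
      by (auto simp: partial_functions_upto_def partial_functions_def)
    obtain ss where ss: "set ss = dom f" "distinct ss"
      using finite_distinct_list[OF f(2)] by auto
    let ?xs = "map (\<lambda>s. (s, the (f s))) ss"
    have "map_of ?xs = f"
      unfolding map_of_map_restrict ss(1)
      by (rule ext) (simp add: restrict_map_def domIff)
    moreover have "?xs \<in> ?L"
      using ss f distinct_card[OF ss(2)] by auto
    ultimately show "f \<in> map_of ` ?L" by (rule image_eqI[OF sym])
  qed
  have fin: "finite ?L" using T(1) by (rule finite_lists_length_le)
  show "finite (partial_functions_upto I m)"
    using sub finite_imageI[OF fin] by (rule finite_subset)
  have "card (partial_functions_upto I m) \<le> card ?L"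
    using card_mono[OF finite_imageI[OF fin] sub] card_image_le[OF fin] by (rule le_trans)
  also have "\<dots> = (\<Sum>i\<le>m. (2 * 2 ^ card I) ^ i)"
    unfolding card_lists_length_le[OF T(1)] T(2) ..
  also have "\<dots> \<le> (\<Sum>i\<le>m. (2 * 2 ^ card I) ^ m)"
    by (intro sum_mono power_increasing) auto
  finally show "card (partial_functions_upto I m) \<le> (m + 1) * (2 * 2 ^ card I) ^ m"
    by simp
qed

lemma eventually_power_times_exp_small:
  fixes c b :: real
  assumes "0 < c"
  shows "eventually (\<lambda>x. b * x ^ k * exp (- c * x) < 1) at_top"
proof -
  have "filterlim (\<lambda>x. c * x) at_top at_top"
    using assms by (intro filterlim_tendsto_pos_mult_at_top[OF tendsto_const]) (auto simp: filterlim_ident)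
  \<comment> \<open>Rescaling by y = c x reduces the claim to y^k / exp y tending to 0.\<close>
  then have "((\<lambda>x. b / c ^ k * ((c * x) ^ k / exp (c * x))) \<longlongrightarrow> b / c ^ k * 0) at_top"
    by (intro tendsto_mult tendsto_const filterlim_compose[OF tendsto_power_div_exp_0])
  then have "eventually (\<lambda>x. b / c ^ k * ((c * x) ^ k / exp (c * x)) < 1) at_top"
    by (rule order_tendstoD) simp
  then show ?thesis
    by eventually_elim (use assms in \<open>simp add: power_mult_distrib exp_minus field_simps\<close>)
qed

theorem theorem3p2:
  fixes m :: nat and \<delta> \<epsilon> :: real
  assumes "0 < \<delta>" and "\<delta> < \<epsilon>" and "\<epsilon> < 1"
  shows "\<exists>n::nat. \<forall>I::nat set. finite I \<and> card I > n \<longrightarrow>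
    (\<exists>C. C \<subseteq> cube I \<and>
      1 - \<epsilon> + \<delta> \<ge> real (card C) * 2 powi (- int (card I)) \<and>
      real (card C) * 2 powi (- int (card I)) \<ge> 1 - \<epsilon> - \<delta> \<and>
      (\<forall>f \<in> partial_functions_upto I m.
        \<bar>real (card (pattern_set I C f)) / real (card (pattern_set I C Map.empty))
          - (1 - \<epsilon>) ^ value_count 0 f * \<epsilon> ^ value_count 1 f\<bar> < \<delta>))"
proof -
  \<comment> \<open>One more than \<open>m\<close>, so that the one-point function giving the
    density of \<open>C\<close> is covered, and the difference bound \<open>k\<close> is positive,
    even for m = 0.\<close>
  define k where "k = Suc m"
  \<comment> \<open>The decay rate: deviation \<delta>N and difference bound \<open>k\<close> on
    \<open>N\<close> points give the tail exponent -(\<delta>N)^2 / (4 k^2 N) = -cN.\<close>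
  define c where "c = \<delta>\<^sup>2 / (4 * (real k)\<^sup>2)"
  have "0 < c" using assms by (simp add: c_def k_def)
  from eventually_power_times_exp_small[OF this]
  \<comment> \<open>The factor 2 counts the two tails; the rest of the coefficient, times x^k at x =
    N, bounds the number of functions.\<close>
  obtain x0 where x0: "\<And>x. x \<ge> x0 \<Longrightarrow> 2 * ((real k + 1) * 2 ^ k) * x ^ k * exp (- c * x) < 1"
    unfolding eventually_at_top_linorder by meson
  show ?thesis
  proof (intro exI[of _ "nat \<lceil>x0\<rceil>"] allI impI, elim conjE)
    fix I :: "nat set" assume I: "finite I" "card I > nat \<lceil>x0\<rceil>"
    define N where "N = real (card (cube I))"
    let ?J = "partial_functions_upto I k"
    have N: "N = 2 ^ card I" using I(1) by (simp add: N_def card_cube)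
    have N_pos: "0 < N" by (simp add: N)
    \<comment> \<open>The threshold is needed for N = 2^|I|, but asking it of |I| suffices.\<close>
    have "real (card I) \<le> N"
      unfolding N using of_nat_mono[OF less_imp_le[OF less_exp[of "card I"]]] by simp
    then have "x0 \<le> N" using I(2) by linarith
    have "real (card ?J) \<le> real ((k + 1) * (2 * 2 ^ card I) ^ k)"
      using partial_functions_upto_bound(2)[OF I(1)] of_nat_mono by blast
    also have "\<dots> = (real k + 1) * 2 ^ k * N ^ k"
      by (simp add: N power_mult_distrib algebra_simps)
    finally have "2 * card ?J * exp (- c * N) \<le> 2 * ((real k + 1) * 2 ^ k) * N ^ k * exp (- c * N)"
      by simp
    also have "\<dots> < 1" using x0[OF \<open>x0 \<le> N\<close>] .
    also have "- c * N = - (\<delta> * N)\<^sup>2 / (4 * (real k)\<^sup>2 * N)"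
      using N_pos by (simp add: c_def power2_eq_square)
    finally have small: "2 * card ?J * exp (- (\<delta> * N)\<^sup>2 / (4 * (real k)\<^sup>2 * N)) < 1" .
    have J: "finite (dom f)" "card (dom f) \<le> k" "dom f \<subseteq> cube I" if "f \<in> ?J" for f
      using that by (auto simp: partial_functions_upto_def partial_functions_def)
    have "\<exists>A\<subseteq>cube I. \<forall>f\<in>?J. \<bar>real (card (pattern_set I A f)) -
        bernoulli_mean (1 - \<epsilon>) (cube I) (\<lambda>A. card (pattern_set I A f))\<bar> < \<delta> * N"
    proof (rule exists_set_near_means[where c = k])
      show "cube I \<noteq> {}" using N_pos by (auto simp: N_def)
      \<comment> \<open>Holds because \<delta> < 1 and k \<ge> 1.\<close>
      show "\<delta> * N \<le> 2 * real k * card (cube I)"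
        using assms N_pos unfolding N_def[symmetric] by (intro mult_right_mono) (auto simp: k_def)
      show "2 * card ?J * exp (- (\<delta> * N)\<^sup>2 / (4 * (real k)\<^sup>2 * card (cube I))) < 1"
        using small by (simp add: N_def)
      show "\<bar>real (card (pattern_set I (insert x A) f)) - card (pattern_set I A f)\<bar> \<le> real k"
        if "f \<in> ?J" "x \<in> cube I" "A \<subseteq> cube I" for f x A
        using pattern_set_bounded_difference[OF I(1) J(1)[OF that(1)] that(2,3)] J(2)[OF that(1)]
        by linarith
    qed (use assms I N_pos in \<open>auto simp: k_def finite_cube partial_functions_upto_bound(1)\<close>)
    then obtain C where C: "C \<subseteq> cube I" and
      near: "\<And>f. f \<in> ?J \<Longrightarrow> \<bar>real (card (pattern_set I C f)) -
        N * ((1 - \<epsilon>) ^ value_count 0 f * \<epsilon> ^ value_count 1 f)\<bar> < \<delta> * N"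
      using bernoulli_mean_card_pattern_set[OF I(1) J(3), where p = "1 - \<epsilon>"] by (auto simp: N_def)
    have density: "\<bar>real (card (pattern_set I C f)) / N -
        (1 - \<epsilon>) ^ value_count 0 f * \<epsilon> ^ value_count 1 f\<bar> < \<delta>" if "f \<in> ?J" for f
    proof -
      let ?q = "(1 - \<epsilon>) ^ value_count 0 f * \<epsilon> ^ value_count 1 f"
      have "real (card (pattern_set I C f)) / N - ?q = (real (card (pattern_set I C f)) - N * ?q) / N"
        using N_pos by (simp add: field_simps)
      then show ?thesis
        using near[OF that] N_pos by (simp add: abs_divide pos_divide_less_eq)
    qed
    \<comment> \<open>Translation by the zero vector \<open>z\<close> fixes the cube, so the pattern
      set of \<open>e\<close> is \<open>C\<close> itself, with target density 1 -
      \<epsilon>.\<close>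
    define z :: "nat \<Rightarrow> bit" where "z = (\<lambda>i\<in>I. 0)"
    define e where "e = [z \<mapsto> (0 :: bit)]"
    have z: "z \<in> cube I" by (simp add: z_def cube_def)
    then have e: "e \<in> ?J"
      by (simp add: e_def k_def partial_functions_upto_def partial_functions_def)
    have e_vals: "{s. e s = Some 0} = {z}" "{s. e s = Some 1} = {}"
      by (auto simp: e_def split: if_splits)
    have "shift I x z = x" if "x \<in> cube I" for x
      using that by (auto simp: shift_def z_def cube_def PiE_def extensional_def fun_eq_iff)
    then have "pattern_set I C e = C"
      using C e_vals by (auto simp: mem_pattern_set subset_iff)
    moreover have "value_count 0 e = 1" "value_count 1 e = 0"
      using e_vals by (simp_all add: value_count_def)
    ultimately have "\<bar>real (card C) / N - (1 - \<epsilon>)\<bar> < \<delta>"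
      using density[OF e] by simp
    moreover have "real (card C) * 2 powi (- int (card I)) = real (card C) / N"
      by (simp add: N power_int_minus field_simps)
    moreover have "?J \<supseteq> partial_functions_upto I m"
      by (auto simp: partial_functions_upto_def k_def)
    ultimately show "\<exists>C. C \<subseteq> cube I \<and>
      1 - \<epsilon> + \<delta> \<ge> real (card C) * 2 powi (- int (card I)) \<and>
      real (card C) * 2 powi (- int (card I)) \<ge> 1 - \<epsilon> - \<delta> \<and>
      (\<forall>f \<in> partial_functions_upto I m.
        \<bar>real (card (pattern_set I C f)) / real (card (pattern_set I C Map.empty))
          - (1 - \<epsilon>) ^ value_count 0 f * \<epsilon> ^ value_count 1 f\<bar> < \<delta>)"
      using C density by (intro exI[of _ C]) (auto simp: pattern_set_empty N_def[symmetric])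
  qed
qed

end
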